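(* Let $k\ge 3$ and let $f_1,f_2$ be two multisets on $\mathbb{Z}_2^{k-1}$ with distinguishing number $k$ that are in standard position, i.e. $\hat f_1(e_1)\cdots\hat f_1(e_{k-1})\hat f_1(h)\ne\hat f_2(e_1)\cdots\hat f_2(e_{k-1})\hat f_2(h)$. Then there exist distinct nonnegative integers $a,b$, positive integers $a_1,\dots,a_{k-1}$ and elements $x_1,x_2\in\mathbb{Z}_2^{k-1}$ such that \[x_1+f_1=f_{(a,b),(a_1,\ldots,a_{k-1})},\qquad x_2+f_2=f_{(b,a),(a_1,\ldots,a_{k-1})}.\]
   Context: A multiset on $\mathbb{Z}_2^m$ is a function $\phi:\mathbb{Z}_2^m\to\mathbb{N}$. Its $i$-deck is $\mathrm{deck}_i\phi(s_1,\dots,s_i)=\sum_{g\in\mathbb{Z}_2^m}\phi(g+s_1)\cdots\phi(g+s_i)$. Two multisets are $k$-indistinguishable if their $i$-decks agree for all $i\le k$, and $k$-distinguishable otherwise; their distinguishing number is the smallest $k$ for which they are $k$-distinguishable. The translate $z+f$ of a multiset $f$ by $z\in\mathbb{Z}_2^m$ is $(z+f)(y)=f(y+z)$. The Fourier transform is $\hat f(x)=\sum_{y}f(y)(-1)^{x_1y_1+\dots+x_my_m}$. Here $e_1,\dots,e_{k-1}$ is the standard basis of $\mathbb{Z}_2^{k-1}$ and $h=e_1+\dots+e_{k-1}$. Identifying $x\in\mathbb{Z}_2^{k-1}$ with $(x_1,\dots,x_{k-1})\in\{0,1\}^{k-1}$, for nonnegative integers $a,b$ and positive integers $a_i$, $f_{(a,b),(a_1,\ldots,a_{k-1})}(x)=a+\sum_i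 a_ix_i$ if $\sum_ix_i$ is even and $=b+\sum_i a_ix_i$ if $\sum_ix_i$ is odd. *)

theory Defs
  imports "HOL-Analysis.Analysis" "HOL-Library.Z2" "HOL-Library.Extended_Nat"
begin

text \<open>
  The group \<open>\<int>\<^sub>2\<^sup>m\<close> is the type \<open>bit ^ 'n\<close> with \<open>m = CARD('n)\<close>, so coordinates are indexed
  by the elements of \<open>'n\<close>; a multiset on it is a function \<open>bit ^ 'n \<Rightarrow> nat\<close>.
\<close>

instance bit :: finite
proof
  have "(UNIV :: bit set) = {0, 1}"
    by (auto intro: bit.exhaust)
  then show "finite (UNIV :: bit set)"
    by (metis finite.emptyI finite.insertI)
qed

text \<open>The arguments \<open>s\<^sub>1, \<dots>, s\<^sub>i\<close> are the values of \<open>s\<close> on \<open>{1..i}\<close>; its other values are irrelevant.\<close>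

definition deck :: "nat \<Rightarrow> (bit ^ 'n \<Rightarrow> nat) \<Rightarrow> (nat \<Rightarrow> bit ^ 'n) \<Rightarrow> nat" where
  "deck i \<phi> s = (\<Sum>g\<in>UNIV. \<Prod>j\<in>{1..i}. \<phi> (g + s j))"

definition indistinguishable :: "nat \<Rightarrow> (bit ^ 'n \<Rightarrow> nat) \<Rightarrow> (bit ^ 'n \<Rightarrow> nat) \<Rightarrow> bool" where
  "indistinguishable k \<phi> \<psi> \<longleftrightarrow> (\<forall>i\<le>k. deck i \<phi> = deck i \<psi>)"

abbreviation distinguishable :: "nat \<Rightarrow> (bit ^ 'n \<Rightarrow> nat) \<Rightarrow> (bit ^ 'n \<Rightarrow> nat) \<Rightarrow> bool" where
  "distinguishable k \<phi> \<psi> \<equiv> \<not> indistinguishable k \<phi> \<psi>"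

text \<open>The value is \<open>\<infinity>\<close> if the multisets are \<open>k\<close>-indistinguishable for every \<open>k\<close>.\<close>

definition distinguishing_number :: "(bit ^ 'n \<Rightarrow> nat) \<Rightarrow> (bit ^ 'n \<Rightarrow> nat) \<Rightarrow> enat" where
  "distinguishing_number \<phi> \<psi> = Inf {enat k | k. distinguishable k \<phi> \<psi>}"

definition translate :: "bit ^ 'n \<Rightarrow> (bit ^ 'n \<Rightarrow> nat) \<Rightarrow> (bit ^ 'n \<Rightarrow> nat)" where
  "translate z f = (\<lambda>y. f (y + z))"

definition fourier :: "(bit ^ 'n \<Rightarrow> nat) \<Rightarrow> bit ^ 'n \<Rightarrow> int" where
  "fourier f x = (\<Sum>y\<in>UNIV. int (f y) * (- 1) ^ (\<Sum>i\<in>UNIV. of_bit (x $ i) * of_bit (y $ i)))"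

definition std_basis :: "'n \<Rightarrow> bit ^ 'n" where
  "std_basis i = axis i 1"

definition basis_sum :: "bit ^ 'n" where
  "basis_sum = (\<Sum>i\<in>UNIV. std_basis i)"

definition standard_position :: "(bit ^ 'n \<Rightarrow> nat) \<Rightarrow> (bit ^ 'n \<Rightarrow> nat) \<Rightarrow> bool" where
  "standard_position f\<^sub>1 f\<^sub>2 \<longleftrightarrow>
     (\<Prod>i\<in>UNIV. fourier f\<^sub>1 (std_basis i)) * fourier f\<^sub>1 basis_sum \<noteq>
     (\<Prod>i\<in>UNIV. fourier f\<^sub>2 (std_basis i)) * fourier f\<^sub>2 basis_sum"

text \<open>
  The multiset \<open>f\<^bsub>(a,b),(a\<^sub>1,\<dots>,a\<^sub>m)\<^esub>\<close>, with the \<open>a\<^sub>i\<close> given by \<open>c\<close>. The parity condition is on the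
  sum of the coordinates taken in \<open>\<nat>\<close>.
\<close>

definition parity_affine :: "nat \<Rightarrow> nat \<Rightarrow> ('n \<Rightarrow> nat) \<Rightarrow> bit ^ 'n \<Rightarrow> nat" where
  "parity_affine a b c x =
     (if even (\<Sum>i\<in>UNIV. of_bit (x $ i) :: nat) then a else b) + (\<Sum>i\<in>UNIV. c i * of_bit (x $ i))"

end

theory Submission
  imports Defs
begin

text \<open>
  The \<open>i\<close>-decks of \<open>f\<^sub>1\<close> and \<open>f\<^sub>2\<close> agree iff \<open>\<Prod>\<^sub>j f\<^sub>1^(x\<^sub>j) = \<Prod>\<^sub>j f\<^sub>2^(x\<^sub>j)\<close> whenever
  \<open>x\<^sub>1 + \<dots> + x\<^sub>i = 0\<close>, where \<open>f^\<close> denotes the Fourier transform. With \<open>i = 2\<close> the two transforms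
  agree up to sign. Standard position makes them nonzero at every \<open>e\<^sub>i\<close> and at \<open>h\<close>, and translations
  change the signs at the \<open>e\<^sub>i\<close> at will, so we may take both transforms to be negative at
  every \<open>e\<^sub>i\<close>; they are then opposite at \<open>h\<close>. For a sum \<open>x\<close> of at least \<open>2\<close> and at most \<open>k - 2\<close>
  basis vectors, the relation between \<open>x\<close> and these basis vectors and the relation between \<open>x\<close>, \<open>h\<close>
  and the remaining ones both have length at most \<open>k - 1\<close>. The first forces equal signs at \<open>x\<close>, the
  second opposite signs, so both transforms vanish at \<open>x\<close>. Fourier inversion on the remaining support
  \<open>{0, e\<^sub>1, \<dots>, e\<^bsub>k-1\<^esub>, h}\<close> gives the claimed form.
\<close>

section \<open>Characters of the group\<close>

definition chi :: "bit ^ 'n \<Rightarrow> bit ^ 'n \<Rightarrow> int" where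
  "chi x y = (- 1) ^ (\<Sum>i\<in>UNIV. of_bit (x $ i) * of_bit (y $ i))"

lemma fourier_chi: "fourier f x = (\<Sum>y\<in>UNIV. int (f y) * chi x y)"
  by (simp add: fourier_def chi_def)

lemma bit_cases: "(b::bit) = 0 \<or> b = 1"
  by (cases b) auto

lemma bit_vec_add_self [simp]: "(x::bit ^ 'n) + x = 0"
  by (simp add: vec_eq_iff)

lemma bit_vec_add_cancel [simp]: "(x::bit ^ 'n) + y + y = x"
  by (simp add: add.assoc)

lemma chi_prod: "chi x y = (\<Prod>i\<in>UNIV. if x $ i = 1 \<and> y $ i = 1 then - 1 else 1)"
  unfolding chi_def power_sum
proof (rule prod.cong)
  show "(- 1) ^ (of_bit (x $ i) * of_bit (y $ i)) = (if x $ i = 1 \<and> y $ i = 1 then - 1 else (1::int))" for i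
    using bit_cases[of "x $ i"] bit_cases[of "y $ i"] by auto
qed simp

lemma chi_commute: "chi x y = chi y x"
  unfolding chi_def by (simp add: mult.commute)

lemma chi_add_right: "chi x (y + z) = chi x y * chi x z"
  unfolding chi_prod prod.distrib[symmetric]
proof (rule prod.cong)
  fix i
  show "(if x $ i = 1 \<and> (y + z) $ i = 1 then - 1 else 1) =
     (if x $ i = 1 \<and> y $ i = 1 then - 1 else 1) * (if x $ i = 1 \<and> z $ i = 1 then - 1 else (1::int))"
    using bit_cases[of "x $ i"] bit_cases[of "y $ i"] bit_cases[of "z $ i"] by auto
qed simp

lemma chi_add_left: "chi (x + y) z = chi x z * chi y z"
  by (metis chi_add_right chi_commute)

lemma chi_zero_right [simp]: "chi x 0 = 1"
  by (simp add: chi_def)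

lemma chi_zero_left [simp]: "chi 0 x = 1"
  by (simp add: chi_def)

lemma chi_square [simp]: "chi x y * chi x y = 1"
  by (simp flip: chi_add_right)

lemma chi_sum_left: "chi (\<Sum>i\<in>A. u i) y = (\<Prod>i\<in>A. chi (u i) y)"
  by (induction A rule: infinite_finite_induct) (auto simp: chi_add_left)

lemma chi_std_basis: "chi (std_basis i) y = 1 - 2 * of_bit (y $ i)"
proof -
  have "chi (std_basis i) y = (\<Prod>j\<in>UNIV. if j = i then if y $ i = 1 then - 1 else 1 else 1)"
    unfolding chi_prod std_basis_def by (rule prod.cong) (auto simp: axis_def)
  then show ?thesis
    using bit_cases[of "y $ i"] by auto
qed

text \<open>Turns the inversion term at \<open>basis_sum\<close> into the case distinction of
  \<open>parity_affine\<close>.\<close>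

lemma chi_basis_sum:
  "chi basis_sum y = (if even (\<Sum>i\<in>UNIV. of_bit (y $ i) :: nat) then 1 else - 1)"
proof -
  have "chi basis_sum y = (\<Prod>i\<in>UNIV. (- 1) ^ of_bit (y $ i))"
    unfolding basis_sum_def chi_sum_left
  proof (rule prod.cong)
    show "chi (std_basis i) y = (- 1) ^ of_bit (y $ i)" for i
      using bit_cases[of "y $ i"] by (auto simp: chi_std_basis)
  qed simp
  then show ?thesis
    by (simp flip: power_sum)
qed

lemma sum_shift: "(\<Sum>g\<in>UNIV. u (g + z)) = (\<Sum>g\<in>UNIV. u (g :: bit ^ 'n))"
  by (rule sum.reindex_bij_witness[of _ "\<lambda>g. g + z" "\<lambda>g. g + z"]) auto

text \<open>For nonzero \<open>y\<close>, shifting \<open>x\<close> by a basis vector where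
  \<open>y\<close> has coordinate 1 negates every term, so the sum equals its own negative.\<close>

lemma chi_orthogonal: "(\<Sum>x\<in>UNIV. chi x y) = (if y = 0 then int CARD(bit ^ 'n) else 0)"
  for y :: "bit ^ 'n"
proof (cases "y = 0")
  case False
  then obtain i where "y $ i = 1"
    using bit_cases by (metis vec_eq_iff zero_index)
  then have "chi (std_basis i) y = - 1"
    by (simp add: chi_std_basis)
  then have "(\<Sum>x\<in>UNIV. chi (x + std_basis i) y) = - (\<Sum>x\<in>UNIV. chi x y)"
    by (simp add: chi_add_left sum_negf)
  with False show ?thesis
    using sum_shift[of "\<lambda>x. chi x y" "std_basis i"] by simp
qed simp

lemma fourier_inversion:
  fixes f :: "bit ^ 'n \<Rightarrow> nat"
  shows "(\<Sum>x\<in>UNIV. fourier f x * chi x y) = int CARD(bit ^ 'n) * int (f y)"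
proof -
  have "(\<Sum>x\<in>UNIV. fourier f x * chi x y) = (\<Sum>x\<in>UNIV. \<Sum>z\<in>UNIV. int (f z) * chi x (z + y))"
    by (simp add: fourier_chi sum_distrib_right chi_add_right mult.assoc)
  also have "\<dots> = (\<Sum>z\<in>UNIV. int (f z) * (\<Sum>x\<in>UNIV. chi x (z + y)))"
    by (subst sum.swap) (simp add: sum_distrib_left)
  also have "\<dots> = (\<Sum>z\<in>UNIV. if z = y then int CARD(bit ^ 'n) * int (f z) else 0)"
  proof (rule sum.cong)
    fix z
    have "z + y = 0 \<longleftrightarrow> z = y"
      by (metis bit_vec_add_cancel add.left_neutral)
    then show "int (f z) * (\<Sum>x\<in>UNIV. chi x (z + y)) =
        (if z = y then int CARD(bit ^ 'n) * int (f z) else 0)"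
      unfolding chi_orthogonal by simp
  qed simp
  finally show ?thesis
    by simp
qed

lemma fourier_translate: "fourier (translate z f) x = chi x z * fourier f x"
proof -
  \<comment> \<open>Writing \<open>y\<close> as \<open>y + z + z\<close> makes the summand a
    function of \<open>y + z\<close>, ready for \<open>sum_shift\<close>.\<close>
  have "fourier (translate z f) x = (\<Sum>y\<in>UNIV. int (f (y + z)) * chi x (y + z + z))"
    by (simp only: fourier_chi translate_def bit_vec_add_cancel)
  also have "\<dots> = (\<Sum>y\<in>UNIV. int (f y) * chi x (y + z))"
    by (rule sum_shift[of "\<lambda>y. int (f y) * chi x (y + z)"])
  finally show ?thesis
    by (simp add: fourier_chi chi_add_right sum_distrib_left mult_ac)
qed

section \<open>Decks\<close>

lemma deck_translate: "deck i (translate z f) = deck i f"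
proof
  fix s
  show "deck i (translate z f) s = deck i f s"
    using sum_shift[of "\<lambda>g. \<Prod>j\<in>{1..i}. f (g + s j)" z]
    by (simp add: deck_def translate_def add_ac)
qed

lemma indistinguishable_translate:
  "indistinguishable k (translate z f) (translate w g) \<longleftrightarrow> indistinguishable k f g"
  by (simp add: indistinguishable_def deck_translate)

text \<open>The left side is the Fourier transform of the deck in all its arguments at once.
  Shifting every \<open>s j\<close> by \<open>g\<close> extracts the character of the sum of the
  \<open>x j\<close> at \<open>g\<close>, which is 1 by assumption.\<close>

lemma deck_fourier:
  fixes f :: "bit ^ 'n \<Rightarrow> nat"
  assumes "(\<Sum>j\<in>{1..i}. x j) = 0"
  shows "(\<Sum>s\<in>{1..i} \<rightarrow>\<^sub>E UNIV. int (deck i f s) * (\<Prod>j\<in>{1..i}. chi (x j) (s j))) =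
    int CARD(bit ^ 'n) * (\<Prod>j\<in>{1..i}. fourier f (x j))"
proof -
  have "(\<Sum>s\<in>{1..i} \<rightarrow>\<^sub>E UNIV. int (deck i f s) * (\<Prod>j\<in>{1..i}. chi (x j) (s j))) =
      (\<Sum>s\<in>{1..i} \<rightarrow>\<^sub>E UNIV. \<Sum>g\<in>UNIV. \<Prod>j\<in>{1..i}. int (f (g + s j)) * chi (x j) (s j))"
    by (simp add: deck_def sum_distrib_right prod.distrib)
  also have "\<dots> =
      (\<Sum>g\<in>UNIV. \<Sum>s\<in>{1..i} \<rightarrow>\<^sub>E UNIV. \<Prod>j\<in>{1..i}. int (f (g + s j)) * chi (x j) (s j))"
    by (rule sum.swap)
  also have "\<dots> = (\<Sum>g\<in>UNIV. \<Prod>j\<in>{1..i}. \<Sum>y\<in>UNIV. int (f (g + y)) * chi (x j) y)"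
    by (subst prod_sum_PiE) auto
  also have "\<dots> = (\<Sum>g\<in>UNIV. \<Prod>j\<in>{1..i}. chi (x j) g * fourier f (x j))"
    unfolding fourier_translate[symmetric]
    by (simp add: fourier_chi translate_def add.commute)
  also have "\<dots> = (\<Sum>g\<in>(UNIV :: (bit ^ 'n) set). \<Prod>j\<in>{1..i}. fourier f (x j))"
    unfolding prod.distrib chi_sum_left[symmetric] assms by simp
  finally show ?thesis
    by simp
qed

lemma indistinguishable_fourier_prod_list:
  fixes f g :: "bit ^ 'n \<Rightarrow> nat"
  assumes "indistinguishable m f g" "length xs \<le> m" "sum_list xs = 0"
  shows "prod_list (map (fourier f) xs) = prod_list (map (fourier g) xs)"
proof -
  define i where "i = length xs"
  \<comment> \<open>Lists count from 0, deck arguments from 1.\<close>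
  define x where "x j = xs ! (j - 1)" for j
  have reindex: "bij_betw (\<lambda>j. j - 1) {1..i} {0..<i}"
    by (rule bij_betw_byWitness[where f' = Suc]) auto
  have "(\<Sum>j\<in>{1..i}. x j) = 0"
    using assms(3) sum.reindex_bij_betw[OF reindex, of "\<lambda>j. xs ! j"]
    by (simp add: x_def sum_list_sum_nth i_def)
  moreover have "deck i f = deck i g"
    using assms by (simp add: indistinguishable_def i_def)
  ultimately have "int CARD(bit ^ 'n) * (\<Prod>j\<in>{1..i}. fourier f (x j)) =
      int CARD(bit ^ 'n) * (\<Prod>j\<in>{1..i}. fourier g (x j))"
    by (simp only: deck_fourier[symmetric])
  then have "(\<Prod>j\<in>{1..i}. fourier f (x j)) = (\<Prod>j\<in>{1..i}. fourier g (x j))"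
    by simp
  moreover have "(\<Prod>j\<in>{1..i}. fourier u (x j)) = prod_list (map (fourier u) xs)" for u
    using prod.reindex_bij_betw[OF reindex, of "\<lambda>j. fourier u (xs ! j)"]
    by (simp add: x_def prod.list_conv_set_nth i_def)
  ultimately show ?thesis
    by simp
qed

lemma distinguishing_number_indistinguishable:
  assumes "distinguishing_number f g = enat k" "i < k"
  shows "indistinguishable i f g"
proof (rule ccontr)
  assume "distinguishable i f g"
  then have "distinguishing_number f g \<le> enat i"
    unfolding distinguishing_number_def by (intro Inf_lower) auto
  with assms show False
    by simp
qed

section \<open>Pairs in standard position\<close>

text \<open>The signs acquired at the basis vectors multiply to \<open>chi basis_sum z\<close>,
  which cancels the sign acquired at \<open>basis_sum\<close>.\<close>

lemma standard_position_translate: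
  fixes f g :: "bit ^ 'n \<Rightarrow> nat"
  shows "standard_position (translate z f) (translate w g) \<longleftrightarrow> standard_position f g"
proof -
  have "(\<Prod>i\<in>UNIV. fourier (translate z f) (std_basis i)) * fourier (translate z f) basis_sum =
      (\<Prod>i\<in>UNIV. fourier f (std_basis i)) * fourier f basis_sum * (chi basis_sum z * chi basis_sum z)"
    for z and f :: "bit ^ 'n \<Rightarrow> nat"
    by (simp add: fourier_translate prod.distrib basis_sum_def chi_sum_left)
  then show ?thesis
    unfolding standard_position_def by simp
qed

text \<open>The relation \<open>x + x = 0\<close> has length 2 and makes the squares agree.\<close>

lemma indistinguishable_fourier_abs:
  assumes "indistinguishable m f g" "2 \<le> m"
  shows "\<bar>fourier f x\<bar> = \<bar>fourier g x\<bar>"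
  using indistinguishable_fourier_prod_list[OF assms(1), of "[x, x]"] assms(2)
  by (simp add: abs_eq_iff square_eq_iff)

text \<open>The transforms have the same zeros, so a zero at one of these points would make both
  products in \<open>standard_position\<close> vanish.\<close>

lemma standard_position_fourier_nonzero:
  assumes "indistinguishable m f g" "2 \<le> m" "standard_position f g"
  shows "fourier f (std_basis i) \<noteq> 0" "fourier g (std_basis i) \<noteq> 0" "fourier f basis_sum \<noteq> 0"
proof -
  have zero_iff: "fourier f x = 0 \<longleftrightarrow> fourier g x = 0" for x
    using indistinguishable_fourier_abs[OF assms(1,2), of x] by auto
  show "fourier f (std_basis i) \<noteq> 0"
  proof
    assume "fourier f (std_basis i) = 0"
    then have "(\<Prod>i\<in>UNIV. fourier f (std_basis i)) = 0" "(\<Prod>i\<in>UNIV. fourier g (std_basis i)) = 0"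
      using zero_iff by auto
    with assms(3) show False
      by (simp add: standard_position_def)
  qed
  then show "fourier g (std_basis i) \<noteq> 0"
    using zero_iff by simp
  show "fourier f basis_sum \<noteq> 0"
    using zero_iff[of basis_sum] assms(3) by (auto simp: standard_position_def)
qed

lemma translate_fourier_basis_neg:
  fixes f :: "bit ^ 'n \<Rightarrow> nat"
  assumes "\<And>i. fourier f (std_basis i) \<noteq> 0"
  obtains z where "\<And>i. fourier (translate z f) (std_basis i) < 0"
proof
  fix i
  \<comment> \<open>Flips the sign exactly at those basis vectors where the transform is
    positive.\<close>
  let ?z = "(\<chi> i. if fourier f (std_basis i) > 0 then 1 else 0) :: bit ^ 'n"
  show "fourier (translate ?z f) (std_basis i) < 0"
    using assms[of i] by (auto simp: fourier_translate chi_std_basis)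
qed

section \<open>Vanishing of the transforms off a small support\<close>

lemma bit_vec_sum_basis: "x = (\<Sum>i\<in>{i. x $ i = 1}. std_basis i)"
proof (subst vec_eq_iff, intro allI)
  fix j
  have "(\<Sum>i\<in>{i. x $ i = 1}. std_basis i $ j) = (\<Sum>i\<in>{i. x $ i = 1}. if i = j then 1 else 0)"
    by (rule sum.cong) (auto simp: std_basis_def axis_def)
  then show "x $ j = (\<Sum>i\<in>{i. x $ i = 1}. std_basis i) $ j"
    using bit_cases[of "x $ j"] by (auto simp: sum.If_cases)
qed

lemma std_basis_index: "std_basis i $ j = (if j = i then 1 else 0)"
  by (simp add: std_basis_def axis_def)

lemma basis_sum_index [simp]: "basis_sum $ i = 1"
  unfolding basis_sum_def std_basis_def by (simp add: axis_def if_distrib cong: if_cong)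

lemma standard_position_fourier_vanish:
  fixes f g :: "bit ^ 'n \<Rightarrow> nat"
  assumes indist: "indistinguishable CARD('n) f g"
    and eq: "\<And>i. fourier f (std_basis i) = fourier g (std_basis i)"
    and nz: "\<And>i. fourier g (std_basis i) \<noteq> 0"
    and opp: "fourier g basis_sum = - fourier f basis_sum" "fourier f basis_sum \<noteq> 0"
    and x: "x \<noteq> 0" "\<And>i. x \<noteq> std_basis i" "x \<noteq> basis_sum"
  shows "fourier f x = 0" "fourier g x = 0"
proof -
  define I where "I = {i. x $ i = 1}"
  have x_sum: "x = sum std_basis I"
    unfolding I_def by (rule bit_vec_sum_basis)
  have "I \<noteq> {}" "I \<noteq> UNIV"
    using x x_sum by (auto simp: basis_sum_def)
  moreover have "card I \<noteq> 1"
  proof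
    assume "card I = 1"
    then obtain i where "I = {i}"
      by (rule card_1_singletonE)
    with x_sum have "x = std_basis i"
      by simp
    with x(2) show False
      by blast
  qed
  moreover have "card I \<noteq> 0"
    using \<open>I \<noteq> {}\<close> by simp
  ultimately have card: "2 \<le> card I" "card I < CARD('n)"
    by (linarith, simp add: psubset_card_mono psubset_eq)
  \<comment> \<open>The nonzero common product is what gets cancelled in both relations
    below.\<close>
  have basis_list: "\<exists>es. length es = card J \<and> sum_list es = sum std_basis J \<and>
      prod_list (map (fourier f) es) = prod_list (map (fourier g) es) \<and>
      prod_list (map (fourier g) es) \<noteq> 0" for J :: "'n set"
  proof -
    obtain js where js: "set js = J" "distinct js"
      using finite_distinct_list[of J] by auto
    have "sum_list (map std_basis js) = sum std_basis J"
      using js by (metis sum_list_distinct_conv_sum_set)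
    moreover have "prod_list (map (fourier g) (map std_basis js)) \<noteq> 0"
      using nz by (auto simp: prod_list_zero_iff)
    ultimately show ?thesis
      using js eq by (intro exI[of _ "map std_basis js"]) (auto simp: distinct_card o_def)
  qed
  obtain es where es: "length es = card I" "sum_list es = sum std_basis I"
      "prod_list (map (fourier f) es) = prod_list (map (fourier g) es)"
      "prod_list (map (fourier g) es) \<noteq> 0"
    using basis_list by blast
  obtain ds where ds: "length ds = card (- I)" "sum_list ds = sum std_basis (- I)"
      "prod_list (map (fourier f) ds) = prod_list (map (fourier g) ds)"
      "prod_list (map (fourier g) ds) \<noteq> 0"
    using basis_list by blast
  have h: "basis_sum = sum std_basis I + sum std_basis (- I)"
    unfolding basis_sum_def by (metis Compl_disjoint Compl_partition finite sum.union_disjoint)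
  \<comment> \<open>Relation of \<open>x\<close> with the basis vectors in \<open>I\<close>; its
    length \<open>card I + 1\<close> is admissible since \<open>I\<close> is not everything.\<close>
  have "fourier f x = fourier g x"
    using indistinguishable_fourier_prod_list[OF indist, of "x # es"] es card
    by (simp flip: x_sum)
  moreover have "fourier f x * fourier f basis_sum = fourier g x * fourier g basis_sum"
  proof -
    \<comment> \<open>The two extra entries fit because \<open>card I\<close> is at least 2.\<close>
    have "length (x # basis_sum # ds) \<le> CARD('n)"
      using ds(1) card by (simp add: Compl_eq_Diff_UNIV card_Diff_subset)
    moreover have "x + (x + sum std_basis (- I) + sum std_basis (- I)) = 0"
      by (simp only: bit_vec_add_cancel bit_vec_add_self)
    then have "sum_list (x # basis_sum # ds) = 0"
      by (simp add: ds(2) h flip: x_sum)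
    ultimately have "prod_list (map (fourier f) (x # basis_sum # ds)) =
        prod_list (map (fourier g) (x # basis_sum # ds))"
      by (rule indistinguishable_fourier_prod_list[OF indist])
    with ds show ?thesis
      by (simp flip: mult.assoc)
  qed
  ultimately show "fourier f x = 0" "fourier g x = 0"
    using opp by auto
qed

section \<open>Recovering the multisets by Fourier inversion\<close>

lemma fourier_inversion_sparse:
  fixes f :: "bit ^ 'n \<Rightarrow> nat"
  assumes "2 \<le> CARD('n)"
    and vanish: "\<And>x. x \<noteq> 0 \<Longrightarrow> (\<And>i. x \<noteq> std_basis i) \<Longrightarrow> x \<noteq> basis_sum \<Longrightarrow> fourier f x = 0"
  shows "int CARD(bit ^ 'n) * int (f y) =
    fourier f 0 + (\<Sum>i\<in>UNIV. fourier f (std_basis i))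
      - 2 * (\<Sum>i\<in>UNIV. fourier f (std_basis i) * of_bit (y $ i))
      + fourier f basis_sum * chi basis_sum y"
proof -
  have inj: "inj (std_basis :: 'n \<Rightarrow> _)"
    by (auto simp: inj_on_def std_basis_def axis_eq_axis)
  \<comment> \<open>In dimension 1 the two would coincide and be counted twice.\<close>
  have "basis_sum \<noteq> std_basis i" for i :: 'n
  proof
    assume "basis_sum = std_basis i"
    then have "std_basis i $ j = 1" for j
      using basis_sum_index[of j] by simp
    then have "j = i" for j
      by (metis std_basis_index zero_neq_one)
    then have "(UNIV :: 'n set) = {i}"
      by auto
    then have "CARD('n) = card {i}"
      by (rule arg_cong)
    then show False
      using assms(1) by simp
  qed
  moreover have "basis_sum \<noteq> (0 :: bit ^ 'n)"
    using basis_sum_index by (metis zero_index zero_neq_one)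
  moreover have "std_basis i \<noteq> 0" for i :: 'n
    by (simp add: std_basis_def axis_eq_0_iff)
  ultimately have distinct: "0 \<notin> insert basis_sum (range (std_basis :: 'n \<Rightarrow> _))"
      "basis_sum \<notin> range (std_basis :: 'n \<Rightarrow> _)"
    by (metis imageE insertE)+
  let ?t = "\<lambda>x. fourier f x * chi x y"
  have "int CARD(bit ^ 'n) * int (f y) = sum ?t UNIV"
    by (rule fourier_inversion[symmetric])
  also have "\<dots> = sum ?t (insert 0 (insert basis_sum (range std_basis)))"
    by (rule sum.mono_neutral_right) (auto intro!: vanish)
  also have "\<dots> = ?t 0 + (?t basis_sum + sum ?t (range std_basis))"
    using distinct by simp
  also have "sum ?t (range std_basis) = (\<Sum>i\<in>UNIV. ?t (std_basis i))"
    using inj by (simp add: sum.reindex)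
  also have "\<dots> = (\<Sum>i\<in>UNIV. fourier f (std_basis i))
      - 2 * (\<Sum>i\<in>UNIV. fourier f (std_basis i) * of_bit (y $ i))"
    unfolding chi_std_basis sum_distrib_left sum_subtractf[symmetric]
    by (rule sum.cong) (simp_all add: algebra_simps)
  finally show ?thesis
    by simp
qed

lemma parity_affine_of_sparse_fourier:
  fixes f g :: "bit ^ 'n \<Rightarrow> nat"
  assumes card: "2 \<le> CARD('n)"
    and indist: "indistinguishable CARD('n) f g"
    and neg: "\<And>i. fourier f (std_basis i) < 0"
    and eq: "\<And>i. fourier f (std_basis i) = fourier g (std_basis i)"
    and opp: "fourier g basis_sum = - fourier f basis_sum" "fourier f basis_sum \<noteq> 0"
  shows "\<exists>a b c. a \<noteq> b \<and> (\<forall>i. c i > 0) \<and> f = parity_affine a b c \<and> g = parity_affine b a c"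
proof -
  have nz: "fourier g (std_basis i) \<noteq> 0" for i
    using neg[of i] eq[of i] by simp
  have zero: "fourier f 0 = fourier g 0"
    using indistinguishable_fourier_prod_list[OF indist, of "[0]"] card by simp
  define N H where "N = int CARD(bit ^ 'n)" and "H = fourier f basis_sum"
  have "N > 0"
    unfolding N_def by (metis of_nat_0_less_iff zero_less_card_finite)
  \<comment> \<open>The part common to both inversions; only the parity term changes sign between
    \<open>f\<close> and \<open>g\<close>.\<close>
  define L where "L y = fourier f 0 + (\<Sum>i\<in>UNIV. fourier f (std_basis i))
    - 2 * (\<Sum>i\<in>UNIV. fourier f (std_basis i) * of_bit (y $ i))" for y :: "bit ^ 'n"
  have f: "N * int (f y) = L y + H * chi basis_sum y" for y
    unfolding N_def H_def L_def
    by (rule fourier_inversion_sparse[OF card])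
      (rule standard_position_fourier_vanish[OF indist eq nz opp])
  have g: "N * int (g y) = L y - H * chi basis_sum y" for y
    using fourier_inversion_sparse[OF card standard_position_fourier_vanish(2)[OF indist eq nz opp], of y]
    by (simp add: N_def H_def L_def eq zero opp)
  \<comment> \<open>At a basis vector the parity is odd, so
    \<open>parity_affine (f 0) (g 0) c\<close> must take the value \<open>g 0 + c i\<close> there.
    The subtraction on naturals is exact by \<open>less\<close>.\<close>
  define c where "c i = f (std_basis i) - g 0" for i
  have L_basis: "L (std_basis i) = L 0 - 2 * fourier f (std_basis i)" for i
    by (simp add: L_def std_basis_def axis_def if_distrib cong: if_cong)
  have odd_basis: "chi basis_sum (std_basis i) = - 1" for i :: 'n
    unfolding chi_commute[of basis_sum] by (simp add: chi_std_basis)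
  \<comment> \<open>Both values carry the parity term \<open>- H\<close>, which cancels.\<close>
  have diff: "N * (int (f (std_basis i)) - int (g 0)) = - 2 * fourier f (std_basis i)" for i
    using f[of "std_basis i"] g[of 0] by (simp add: L_basis odd_basis right_diff_distrib)
  have less: "g 0 < f (std_basis i)" for i
  proof -
    have "0 < N * (int (f (std_basis i)) - int (g 0))"
      using neg[of i] diff[of i] by simp
    then show ?thesis
      using \<open>N > 0\<close> by (simp add: zero_less_mult_iff)
  qed
  have c: "N * int (c i) = - 2 * fourier f (std_basis i)" for i
    using diff[of i] less[of i] by (simp add: c_def of_nat_diff less_imp_le)
  have L: "L y = L 0 + N * (\<Sum>i\<in>UNIV. int (c i) * of_bit (y $ i))" for y
  proof -
    have "N * (\<Sum>i\<in>UNIV. int (c i) * of_bit (y $ i)) =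
        - 2 * (\<Sum>i\<in>UNIV. fourier f (std_basis i) * of_bit (y $ i))"
      unfolding sum_distrib_left mult.assoc[symmetric] c ..
    then show ?thesis
      by (simp add: L_def)
  qed
  \<comment> \<open>At 0 the inversions read \<open>N * f 0 = L 0 + H\<close> and
    \<open>N * g 0 = L 0 - H\<close>, which gives the constants for even and odd parity.\<close>
  have "f y = parity_affine (f 0) (g 0) c y" for y
  proof -
    have "N * int (f y) = N * int (parity_affine (f 0) (g 0) c y)"
      using f[of 0] g[of 0] L[of y]
      by (simp add: f[of y] parity_affine_def chi_basis_sum distrib_left)
    then show ?thesis
      using \<open>N > 0\<close> by simp
  qed
  moreover have "g y = parity_affine (g 0) (f 0) c y" for y
  proof -
    have "N * int (g y) = N * int (parity_affine (g 0) (f 0) c y)"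
      using f[of 0] g[of 0] L[of y]
      by (simp add: g[of y] parity_affine_def chi_basis_sum distrib_left)
    then show ?thesis
      using \<open>N > 0\<close> by simp
  qed
  moreover have "f 0 \<noteq> g 0"
    using f[of 0] g[of 0] opp(2) by (auto simp: H_def)
  moreover have "c i > 0" for i
    using less by (simp add: c_def)
  ultimately show ?thesis
    by blast
qed

theorem theorem4p4:
  fixes k :: nat
    and f\<^sub>1 f\<^sub>2 :: "bit ^ 'n \<Rightarrow> nat"
  assumes "k \<ge> 3"
    and "CARD('n) = k - 1"
    and "distinguishing_number f\<^sub>1 f\<^sub>2 = enat k"
    and "standard_position f\<^sub>1 f\<^sub>2"
  shows "\<exists>(a::nat) (b::nat) (c::'n \<Rightarrow> nat) (x\<^sub>1::bit ^ 'n) (x\<^sub>2::bit ^ 'n).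
           a \<noteq> b \<and> (\<forall>i. c i > 0) \<and>
           translate x\<^sub>1 f\<^sub>1 = parity_affine a b c \<and>
           translate x\<^sub>2 f\<^sub>2 = parity_affine b a c"
proof -
  have card: "2 \<le> CARD('n)" "CARD('n) < k"
    using assms(1,2) by auto
  then have indist: "indistinguishable CARD('n) f\<^sub>1 f\<^sub>2"
    using assms(3) distinguishing_number_indistinguishable by blast
  note nonzero = standard_position_fourier_nonzero[OF indist card(1) assms(4)]
  obtain x\<^sub>1 where x\<^sub>1: "\<And>i. fourier (translate x\<^sub>1 f\<^sub>1) (std_basis i) < 0"
    using translate_fourier_basis_neg nonzero(1) by blast
  obtain x\<^sub>2 where x\<^sub>2: "\<And>i. fourier (translate x\<^sub>2 f\<^sub>2) (std_basis i) < 0"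
    using translate_fourier_basis_neg nonzero(2) by blast
  let ?f = "translate x\<^sub>1 f\<^sub>1" and ?g = "translate x\<^sub>2 f\<^sub>2"
  have indist': "indistinguishable CARD('n) ?f ?g"
    using indist by (simp add: indistinguishable_translate)
  have position: "standard_position ?f ?g"
    using assms(4) by (simp add: standard_position_translate)
  \<comment> \<open>Equal absolute values and both negative.\<close>
  have eq: "fourier ?f (std_basis i) = fourier ?g (std_basis i)" for i
    using indistinguishable_fourier_abs[OF indist' card(1), of "std_basis i"] x\<^sub>1[of i] x\<^sub>2[of i]
    by simp
  \<comment> \<open>The products over the basis vectors agree, so standard position can only come
    from \<open>basis_sum\<close>.\<close>
  have "fourier ?f basis_sum \<noteq> fourier ?g basis_sum"
    using position by (auto simp: standard_position_def eq)
  then have "fourier ?g basis_sum = - fourier ?f basis_sum"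
    using indistinguishable_fourier_abs[OF indist' card(1), of basis_sum] by linarith
  with parity_affine_of_sparse_fourier[OF card(1) indist' x\<^sub>1 eq]
    standard_position_fourier_nonzero(3)[OF indist' card(1) position]
  show ?thesis
    by blast
qed

end
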